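(* Let $\alpha\in\mathcal S_n$ and $f=\Delta(\alpha)$. Then: (i) the number of cycles of $\alpha$ equals the number of occurrences of the letter $b_0$ in $f$; (ii) $\alpha$ is indecomposable if and only if $f$ is primitive; (iii) if $\alpha$ is indecomposable, then the number of left-to-right maxima of $\alpha$ equals the number of occurrences of the letter $b_1$ in $f$.
   Context: Permutations are written as sequences $a_1,\dots,a_n$ ($a_i$ the image of $i$); $\alpha$ is decomposable if there is $p<n$ with $1\le a_i\le p$ for all $i\le p$, indecomposable otherwise; $a_i$ is a left-to-right maximum if $a_j<a_i$ for all $j<i$. The word $\Delta(\alpha)$ over the alphabet $\{a,b_0,b_1,b_2,\dots\}$ is built by processing $i=1,2,\dots,n$ in order, maintaining a list of rows ("opened cycles") of cells, rows in order of creation, each cell either free or filled. If $i$ is the smallest element of its cycle in $\alpha$ and this cycle has length $k$, a new row with $k$ cells is appended at the end of the list, $i$ is put in its first cell, the other $k-1$ cells are free, and $f_i=a^kb_0$. Otherwise, writing the cycle of $\alpha$ containing $i$ as $(c,\alpha(c),\alpha^2(c),\dots)$ with $c$ its smallest element and $i=\alpha^r(c)$, $i$ is put in the $(r+1)$-th cell of the row of $c$, and $f_i=b_j$ where $j$ is found as follows: the pivot is the smallest element already placed whose right neighbouring cell in its row is free; list the free cells in reading order (rows in order of creation, cells from left to right), starting with the cell immediately to the right of the pivot and continuing cyclically (after the last free cell of the last row, continue with the first free cell of the first row); $j$ is the rank (starting at 1) of the cell receiving $i$ in this list. Finally $\Delta(\alpha)=f_1f_2\cdots f_n$. Replacing every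 $b_j$ by $b$ gives a Dyck path (a word over $\{a,b\}$ with equally many $a$'s and $b$'s, every prefix having at least as many $a$'s as $b$'s); $f$ is primitive if this Dyck path is nonempty and is not the concatenation of two nonempty Dyck paths.
   Formalization: Part (iii) is stated for n ≠ 1, since for n = 1 the identity is indecomposable with one left-to-right maximum while f = a b_0 has no b_1; part (ii) is stated for n ≥ 1, since the empty permutation is indecomposable but the empty word is not primitive. *)

theory Defs
  imports "HOL-Combinatorics.Orbits"
begin

text \<open>A permutation of size \<open>n\<close> is a function \<open>\<alpha>\<close> with \<^term>\<open>\<alpha> permutes {1..n}\<close>; its cycles are the
  orbits of the elements of \<^term>\<open>{1..n}\<close>, fixed points included.\<close>

definition cycles_on :: "(nat \<Rightarrow> nat) \<Rightarrow> nat \<Rightarrow> nat set set" where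
  "cycles_on \<alpha> n = orbit \<alpha> ` {1..n}"

definition decomposable :: "(nat \<Rightarrow> nat) \<Rightarrow> nat \<Rightarrow> bool" where
  "decomposable \<alpha> n \<longleftrightarrow> (\<exists>p\<in>{1..<n}. \<forall>i\<in>{1..p}. 1 \<le> \<alpha> i \<and> \<alpha> i \<le> p)"

definition indecomposable :: "(nat \<Rightarrow> nat) \<Rightarrow> nat \<Rightarrow> bool" where
  "indecomposable \<alpha> n \<longleftrightarrow> \<not> decomposable \<alpha> n"

definition left_to_right_maxima :: "(nat \<Rightarrow> nat) \<Rightarrow> nat \<Rightarrow> nat set" where
  "left_to_right_maxima \<alpha> n = {i\<in>{1..n}. \<forall>j\<in>{1..<i}. \<alpha> j < \<alpha> i}"


datatype letter = A | B nat

datatype step = StepA | StepB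

primrec erase_index :: "letter \<Rightarrow> step" where
  "erase_index A = StepA"
| "erase_index (B j) = StepB"

definition dyck_path :: "step list \<Rightarrow> bool" where
  "dyck_path w \<longleftrightarrow> count_list w StepA = count_list w StepB \<and>
     (\<forall>k\<le>length w. count_list (take k w) StepB \<le> count_list (take k w) StepA)"

definition primitive_dyck_path :: "step list \<Rightarrow> bool" where
  "primitive_dyck_path w \<longleftrightarrow> dyck_path w \<and> w \<noteq> [] \<and>
     \<not> (\<exists>u v. dyck_path u \<and> dyck_path v \<and> u \<noteq> [] \<and> v \<noteq> [] \<and> w = u @ v)"

definition primitive :: "letter list \<Rightarrow> bool" where
  "primitive f \<longleftrightarrow> primitive_dyck_path (map erase_index f)"


text \<open>The opened cycles: a list of rows in order of creation. A cell of a row contains \<^term>\<open>None\<close>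
  if it is free and \<^term>\<open>Some x\<close> if it is filled with \<open>x\<close>. The cell \<open>(q, s)\<close> is the one in
  row \<open>q\<close> and column \<open>s\<close>, both counted from 0.\<close>

type_synonym rows = "nat option list list"

definition cells :: "rows \<Rightarrow> (nat \<times> nat) list" where
  "cells R = [(q, s). q \<leftarrow> [0..<length R], s \<leftarrow> [0..<length (R ! q)]]"

definition content :: "rows \<Rightarrow> nat \<times> nat \<Rightarrow> nat option" where
  "content R p = R ! fst p ! snd p"

definition free_cells :: "rows \<Rightarrow> (nat \<times> nat) list" where
  "free_cells R = filter (\<lambda>p. content R p = None) (cells R)"

definition cell_of :: "rows \<Rightarrow> nat \<Rightarrow> nat \<times> nat" where
  "cell_of R x = (THE p. p \<in> set (cells R) \<and> content R p = Some x)"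

definition right_cell :: "nat \<times> nat \<Rightarrow> nat \<times> nat" where
  "right_cell p = (fst p, Suc (snd p))"

text \<open>If \<open>p\<close> is the last cell of its row, then \<^term>\<open>right_cell p\<close> is not a cell, so it is not a free cell.\<close>

definition pivot :: "rows \<Rightarrow> nat" where
  "pivot R = (LEAST x. \<exists>p\<in>set (cells R). content R p = Some x \<and> right_cell p \<in> set (free_cells R))"

definition cyclic_from :: "'a \<Rightarrow> 'a list \<Rightarrow> 'a list" where
  "cyclic_from p ps = dropWhile (\<lambda>x. x \<noteq> p) ps @ takeWhile (\<lambda>x. x \<noteq> p) ps"

definition rank_in :: "'a \<Rightarrow> 'a list \<Rightarrow> nat" where
  "rank_in p ps = Suc (length (takeWhile (\<lambda>x. x \<noteq> p) ps))"

definition free_cells_from_pivot :: "rows \<Rightarrow> (nat \<times> nat) list" where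
  "free_cells_from_pivot R = cyclic_from (right_cell (cell_of R (pivot R))) (free_cells R)"


definition cycle_min :: "(nat \<Rightarrow> nat) \<Rightarrow> nat \<Rightarrow> nat" where
  "cycle_min \<alpha> i = Min (orbit \<alpha> i)"

text \<open>The cell receiving an \<open>i\<close> that is not the smallest element \<open>c\<close> of its cycle:
  \<^term>\<open>funpow_dist \<alpha> c i\<close> is the least \<open>r\<close> with \<open>i = \<alpha>\<^sup>r(c)\<close>.\<close>

definition target_cell :: "(nat \<Rightarrow> nat) \<Rightarrow> nat \<Rightarrow> rows \<Rightarrow> nat \<times> nat" where
  "target_cell \<alpha> i R =
     (let c = cycle_min \<alpha> i in (fst (cell_of R c), funpow_dist \<alpha> c i))"

definition place :: "(nat \<Rightarrow> nat) \<Rightarrow> nat \<Rightarrow> rows \<Rightarrow> rows" where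
  "place \<alpha> i R =
     (if i = cycle_min \<alpha> i
      then R @ [Some i # replicate (card (orbit \<alpha> i) - 1) None]
      else let (q, s) = target_cell \<alpha> i R in R[q := (R ! q)[s := Some i]])"

primrec rows_after :: "(nat \<Rightarrow> nat) \<Rightarrow> nat \<Rightarrow> rows" where
  "rows_after \<alpha> 0 = []"
| "rows_after \<alpha> (Suc i) = place \<alpha> (Suc i) (rows_after \<alpha> i)"

definition factor :: "(nat \<Rightarrow> nat) \<Rightarrow> nat \<Rightarrow> letter list" where
  "factor \<alpha> i =
     (if i = cycle_min \<alpha> i
      then replicate (card (orbit \<alpha> i)) A @ [B 0]
      else let R = rows_after \<alpha> (i - 1)
           in [B (rank_in (target_cell \<alpha> i R) (free_cells_from_pivot R))])"

definition Delta :: "(nat \<Rightarrow> nat) \<Rightarrow> nat \<Rightarrow> letter list" where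
  "Delta \<alpha> n = concat (map (factor \<alpha>) [1..<Suc n])"

end

theory Submission
  imports Defs "HOL-Library.Sublist"
begin

text \<open>At time \<open>i\<close> every cycle with minimum \<open>m \<le> i\<close> has its row, whose cell \<open>r\<close> belongs to
  \<open>\<alpha>\<^sup>r(m)\<close> and is filled iff \<open>\<alpha>\<^sup>r(m) \<le> i\<close>.

  The word of \<open>f\<^sub>1\<dots>f\<^sub>i\<close> has \<open>i\<close> down-steps and one up-step for each \<open>x\<close> with \<open>cycle_min \<alpha> x \<le> i\<close>;
  these \<open>x\<close> include \<open>1, \<dots>, i\<close>, with equality iff \<open>\<alpha>\<close> preserves \<open>{1..i}\<close>. So the
  decompositions of the Dyck path are those of \<open>\<alpha>\<close>.

  When \<open>i + 1\<close> is placed, the pivot is the least \<open>x \<le> i\<close> with \<open>\<alpha> x > i\<close>, and the letter is \<open>b\<^sub>1\<close> iff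
  \<open>\<alpha> x = i + 1\<close>. Hence \<open>b\<^sub>1\<close> counts the left-to-right maxima at positions \<open>x < \<alpha> x\<close>. A left-to-right
  maximum at \<open>x \<ge> \<alpha> x\<close> makes \<open>{1..x}\<close> invariant, which for indecomposable \<open>\<alpha>\<close> forces \<open>x = n\<close> and
  \<open>\<alpha> n = n\<close>, hence \<open>n = 1\<close>.\<close>

section \<open>Dyck paths and cyclic lists\<close>

lemma count_list_replicate: "count_list (replicate k x) y = (if x = y then k else 0)"
  by (induction k) auto

text \<open>A prefix of \<open>u\<close> is a prefix of \<open>u @ v\<close>. A prefix of
  \<open>v\<close> becomes one after putting \<open>u\<close> in front, and the balanced
  \<open>u\<close> cancels from both counts.\<close>

lemma dyck_path_append:
  assumes "dyck_path (u @ v)" "count_list u StepA = count_list u StepB"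
  shows "dyck_path u" "dyck_path v"
proof -
  have le: "count_list (take k (u @ v)) StepB \<le> count_list (take k (u @ v)) StepA"
    if "k \<le> length (u @ v)" for k
    using assms(1) that by (simp add: dyck_path_def)
  show "dyck_path u"
    unfolding dyck_path_def
  proof (intro conjI allI impI assms(2))
    fix k assume "k \<le> length u"
    with le[of k] show "count_list (take k u) StepB \<le> count_list (take k u) StepA"
      by simp
  qed
  show "dyck_path v"
    unfolding dyck_path_def
  proof (intro conjI allI impI)
    show "count_list v StepA = count_list v StepB"
      using assms by (simp add: dyck_path_def)
    fix k assume "k \<le> length v"
    with le[of "length u + k"] assms(2)
    show "count_list (take k v) StepB \<le> count_list (take k v) StepA"
      by simp
  qed
qed

text \<open>Since \<open>p\<close> occurs in \<open>ps\<close>, \<open>dropWhile\<close> stops at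
  it, so the rotated list has head \<open>p\<close>; rank 1 is the position of the head.\<close>

lemma rank_in_cyclic_from:
  assumes "p \<in> set ps"
  shows "rank_in x (cyclic_from p ps) = 1 \<longleftrightarrow> x = p"
proof -
  have "dropWhile (\<lambda>x. x \<noteq> p) ps \<noteq> []"
    using assms by (simp add: dropWhile_eq_Nil_conv)
  then obtain ys where "dropWhile (\<lambda>x. x \<noteq> p) ps = p # ys"
    using hd_dropWhile by (metis (mono_tags, lifting) list.exhaust_sel)
  then show ?thesis by (auto simp: rank_in_def cyclic_from_def)
qed

section \<open>Orbits and cycle minima\<close>

locale interval_permutation =
  fixes \<alpha> :: "nat \<Rightarrow> nat" and n :: nat
  assumes permutes: "\<alpha> permutes {1..n}"
begin

lemma permutation: "permutation \<alpha>"
  using permutes by (auto simp: permutation_permutes)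

lemma inj: "inj \<alpha>"
  using permutes by (rule permutes_inj)

lemma self_in_orbit: "x \<in> orbit \<alpha> x"
  by (rule permutation_self_in_orbit[OF permutation])

lemma finite_orbit: "finite (orbit \<alpha> x)"
  by (rule Orbits.finite_orbit[OF self_in_orbit])

lemma orbit_eq: "y \<in> orbit \<alpha> x \<Longrightarrow> orbit \<alpha> y = orbit \<alpha> x"
  using cyclic_on_orbit'[OF permutation] by (rule orbit_cyclic_eq3)

lemma cycle_min_in_orbit: "cycle_min \<alpha> x \<in> orbit \<alpha> x"
  unfolding cycle_min_def using finite_orbit orbit_nonempty by (rule Min_in)

lemma cycle_min_le: "y \<in> orbit \<alpha> x \<Longrightarrow> cycle_min \<alpha> x \<le> y"
  unfolding cycle_min_def using finite_orbit by (rule Min_le)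

lemma orbit_cycle_min: "orbit \<alpha> (cycle_min \<alpha> x) = orbit \<alpha> x"
  using cycle_min_in_orbit by (rule orbit_eq)

lemma cycle_min_eq: "y \<in> orbit \<alpha> x \<Longrightarrow> cycle_min \<alpha> y = cycle_min \<alpha> x"
  by (simp add: cycle_min_def orbit_eq)

lemma cycle_min_eq_iff: "cycle_min \<alpha> x = cycle_min \<alpha> y \<longleftrightarrow> orbit \<alpha> x = orbit \<alpha> y"
  by (metis cycle_min_def orbit_cycle_min)

lemma cycle_min_idem: "cycle_min \<alpha> (cycle_min \<alpha> x) = cycle_min \<alpha> x"
  by (rule cycle_min_eq[OF cycle_min_in_orbit])

lemma in_orbit_cycle_min: "x \<in> orbit \<alpha> (cycle_min \<alpha> x)"
  by (simp add: orbit_cycle_min self_in_orbit)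

lemma cycle_min_self_le: "cycle_min \<alpha> x \<le> x"
  by (rule cycle_min_le[OF self_in_orbit])

lemma cycle_min_less: "cycle_min \<alpha> x \<noteq> x \<Longrightarrow> cycle_min \<alpha> x < x"
  using cycle_min_self_le[of x] by simp

lemma cycle_min_step: "cycle_min \<alpha> (\<alpha> x) = cycle_min \<alpha> x"
  by (rule cycle_min_eq[OF orbit.base])

lemma funpow_in_orbit: "(\<alpha> ^^ r) x \<in> orbit \<alpha> x"
  by (rule Orbits.funpow_in_orbit[OF self_in_orbit])

lemma cycle_min_funpow: "cycle_min \<alpha> ((\<alpha> ^^ r) x) = cycle_min \<alpha> x"
  by (rule cycle_min_eq[OF funpow_in_orbit])

lemma zero_fixed: "\<alpha> 0 = 0"
  using permutes by (simp add: permutes_not_in)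

text \<open>The point 0 lies outside \<open>{1..n}\<close>, hence is fixed and shares its orbit with
  no positive point.\<close>

lemma cycle_min_pos_iff: "0 < cycle_min \<alpha> x \<longleftrightarrow> 0 < x"
proof
  assume "0 < x"
  have "orbit \<alpha> 0 = {0}"
    by (simp add: orbit_eq_singleton_iff zero_fixed)
  with in_orbit_cycle_min[of x] \<open>0 < x\<close> show "0 < cycle_min \<alpha> x"
    by (metis gr0I singletonD)
qed (use cycle_min_self_le[of x] in simp)

lemma orbit_subset: "x \<in> {1..n} \<Longrightarrow> orbit \<alpha> x \<subseteq> {1..n}"
  using permutes by (rule permutes_orbit_subset)

lemma card_orbit_eq: "card (orbit \<alpha> x) = funpow_dist1 \<alpha> x x"
  by (subst orbit_conv_funpow_dist1[OF self_in_orbit])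
    (simp add: card_image inj_on_funpow_dist1 self_in_orbit)

lemma card_orbit_pos: "0 < card (orbit \<alpha> x)"
  by (simp add: card_orbit_eq)

lemma funpow_card_orbit: "(\<alpha> ^^ card (orbit \<alpha> x)) x = x"
  unfolding card_orbit_eq by (rule funpow_dist1_prop[OF self_in_orbit])

lemma funpow_inj:
  assumes "r < card (orbit \<alpha> x)" "s < card (orbit \<alpha> x)" "(\<alpha> ^^ r) x = (\<alpha> ^^ s) x"
  shows "r = s"
  using inj_onD[OF inj_on_funpow_dist1[OF self_in_orbit], of r x s] assms
  by (simp add: card_orbit_eq)

lemma funpow_dist_less_card:
  assumes "y \<in> orbit \<alpha> x"
  shows "funpow_dist \<alpha> x y < card (orbit \<alpha> x)"
proof -
  have "y \<in> (\<lambda>r. (\<alpha> ^^ r) x) ` {0..<card (orbit \<alpha> x)}"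
    using assms unfolding card_orbit_eq by (subst (asm) orbit_conv_funpow_dist1[OF self_in_orbit])
  then obtain r where "r < card (orbit \<alpha> x)" "(\<alpha> ^^ r) x = y"
    by auto
  then show ?thesis
    \<comment> \<open>\<open>funpow_dist\<close> is the least exponent reaching \<open>y\<close>, so
      it is at most \<open>r\<close>.\<close>
    by (metis funpow_dist_least linorder_not_less order_le_less_trans)
qed

lemma funpow_dist: "(\<alpha> ^^ funpow_dist \<alpha> (cycle_min \<alpha> x) x) (cycle_min \<alpha> x) = x"
  by (rule funpow_dist_prop[OF in_orbit_cycle_min])

section \<open>Closed form of the rows\<close>

text \<open>Rows are created at cycle minima in increasing order, so this sorted list indexes them.
  There is no cut at \<open>n\<close>: larger points are fixed and open rows with one cell.\<close>

definition opened :: "nat \<Rightarrow> nat list" where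
  "opened i = filter (\<lambda>m. cycle_min \<alpha> m = m) [1..<Suc i]"

definition row_at :: "nat \<Rightarrow> nat \<Rightarrow> nat option list" where
  "row_at i m = map (\<lambda>r. if (\<alpha> ^^ r) m \<le> i then Some ((\<alpha> ^^ r) m) else None)
     [0..<card (orbit \<alpha> m)]"

definition rows_at :: "nat \<Rightarrow> rows" where
  "rows_at i = map (row_at i) (opened i)"

text \<open>The element destined for a cell, whether or not it has been placed yet; free cells can
  thus be compared through their future contents.\<close>

definition cell_value :: "nat \<Rightarrow> nat \<times> nat \<Rightarrow> nat" where
  "cell_value i p = (\<alpha> ^^ snd p) (opened i ! fst p)"

lemma set_opened: "set (opened i) = {m\<in>{1..i}. cycle_min \<alpha> m = m}"
  by (auto simp: opened_def)

lemma distinct_opened: "distinct (opened i)"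
  by (simp add: opened_def)

lemma length_row_at [simp]: "length (row_at i m) = card (orbit \<alpha> m)"
  by (simp add: row_at_def)

lemma opened_nth:
  assumes "q < length (opened i)"
  shows "opened i ! q \<in> {1..i}" "cycle_min \<alpha> (opened i ! q) = opened i ! q"
  using nth_mem[OF assms] unfolding set_opened by auto

lemma mem_cells: "p \<in> set (cells R) \<longleftrightarrow> fst p < length R \<and> snd p < length (R ! fst p)"
  by (cases p) (auto simp: cells_def image_iff)

lemma mem_cells_rows_at:
  "p \<in> set (cells (rows_at i)) \<longleftrightarrow>
     fst p < length (opened i) \<and> snd p < card (orbit \<alpha> (opened i ! fst p))"
  by (auto simp: mem_cells rows_at_def)

lemma content_rows_at:
  assumes "p \<in> set (cells (rows_at i))"
  shows "content (rows_at i) p = (if cell_value i p \<le> i then Some (cell_value i p) else None)"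
  using assms unfolding mem_cells_rows_at
  by (simp add: content_def rows_at_def row_at_def cell_value_def)

lemma cycle_min_cell_value:
  assumes "p \<in> set (cells (rows_at i))"
  shows "cycle_min \<alpha> (cell_value i p) = opened i ! fst p"
  using assms by (simp add: cell_value_def cycle_min_funpow mem_cells_rows_at opened_nth)

text \<open>The value determines its cycle minimum and hence the row; within a row, powers of
  \<open>\<alpha>\<close> with exponent below the cycle length are distinct.\<close>

lemma cell_value_inj:
  assumes "p \<in> set (cells (rows_at i))" "p' \<in> set (cells (rows_at i))"
    and "cell_value i p = cell_value i p'"
  shows "p = p'"
proof -
  have eq: "opened i ! fst p = opened i ! fst p'"
    using assms cycle_min_cell_value by metis
  then have 1: "fst p = fst p'"
    using assms distinct_opened nth_eq_iff_index_eq mem_cells_rows_at by metis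
  moreover have "snd p = snd p'"
    using assms 1 unfolding mem_cells_rows_at cell_value_def by (auto intro: funpow_inj)
  ultimately show ?thesis by (simp add: prod_eq_iff)
qed

lemma cell_value_pos:
  assumes "p \<in> set (cells (rows_at i))"
  shows "0 < cell_value i p"
proof -
  have "0 < cycle_min \<alpha> (cell_value i p)"
    using assms by (simp add: cycle_min_cell_value mem_cells_rows_at) (use opened_nth in force)
  then show ?thesis by (simp add: cycle_min_pos_iff)
qed

lemma cell_of_rows_at:
  assumes "p \<in> set (cells (rows_at i))" "cell_value i p \<le> i"
  shows "cell_of (rows_at i) (cell_value i p) = p"
  unfolding cell_of_def
proof (rule the_equality)
  fix p' assume "p' \<in> set (cells (rows_at i)) \<and> content (rows_at i) p' = Some (cell_value i p)"
  then show "p' = p"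
    using assms by (auto simp: content_rows_at split: if_splits intro: cell_value_inj)
qed (use assms in \<open>simp add: content_rows_at\<close>)

text \<open>Locates the cell reserved for \<open>x\<close> once the row of its cycle is open. It
  serves both for the target of a new element and for the cell of one already placed.\<close>

lemma ex_cell:
  assumes "0 < x" "cycle_min \<alpha> x \<le> i"
  obtains q where "q < length (opened i)" "opened i ! q = cycle_min \<alpha> x"
    "(q, funpow_dist \<alpha> (cycle_min \<alpha> x) x) \<in> set (cells (rows_at i))"
    "cell_value i (q, funpow_dist \<alpha> (cycle_min \<alpha> x) x) = x"
    "cell_of (rows_at i) (cycle_min \<alpha> x) = (q, 0)"
proof -
  have "cycle_min \<alpha> x \<in> set (opened i)"
    using assms cycle_min_pos_iff[of x] by (simp add: set_opened cycle_min_idem)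
  then obtain q where q: "q < length (opened i)" "opened i ! q = cycle_min \<alpha> x"
    by (auto simp: in_set_conv_nth)
  have "(q, funpow_dist \<alpha> (cycle_min \<alpha> x) x) \<in> set (cells (rows_at i))"
    using q by (simp add: mem_cells_rows_at funpow_dist_less_card in_orbit_cycle_min)
  moreover have "cell_value i (q, funpow_dist \<alpha> (cycle_min \<alpha> x) x) = x"
    using q by (simp add: cell_value_def funpow_dist)
  moreover have "cell_of (rows_at i) (cycle_min \<alpha> x) = (q, 0)"
    using cell_of_rows_at[of "(q, 0)" i] q assms
    by (simp add: mem_cells_rows_at cell_value_def card_orbit_pos)
  ultimately show thesis using q that by blast
qed

lemma target_cell_rows_at:
  assumes "0 < x" "cycle_min \<alpha> x \<le> i"
  shows "target_cell \<alpha> x (rows_at i) \<in> set (cells (rows_at i))"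
    and "cell_value i (target_cell \<alpha> x (rows_at i)) = x"
  by (rule ex_cell[OF assms]; simp add: target_cell_def Let_def)+

lemma row_at_Suc:
  assumes "Suc i \<notin> orbit \<alpha> m"
  shows "row_at (Suc i) m = row_at i m"
proof -
  have "(\<alpha> ^^ r) m \<noteq> Suc i" for r
    using assms funpow_in_orbit by metis
  then show ?thesis by (auto simp: row_at_def le_Suc_eq)
qed

lemma not_in_orbit_opened:
  assumes "m \<in> set (opened i)" "m \<noteq> cycle_min \<alpha> x"
  shows "x \<notin> orbit \<alpha> m"
  using assms cycle_min_eq by (auto simp: set_opened)

text \<open>All other elements of the cycle exceed \<open>m\<close>, so at time \<open>m\<close>
  only the first cell is filled.\<close>

lemma row_at_cycle_min:
  assumes "cycle_min \<alpha> m = m"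
  shows "row_at m m = Some m # replicate (card (orbit \<alpha> m) - 1) None"
proof (rule nth_equalityI)
  show "length (row_at m m) = length (Some m # replicate (card (orbit \<alpha> m) - 1) None)"
    using card_orbit_pos[of m] by simp
  fix r assume "r < length (row_at m m)"
  then have r: "r < card (orbit \<alpha> m)" by simp
  show "row_at m m ! r = (Some m # replicate (card (orbit \<alpha> m) - 1) None) ! r"
  proof (cases r)
    case (Suc s)
    have "m \<le> (\<alpha> ^^ r) m"
      using assms cycle_min_le funpow_in_orbit by metis
    moreover have "(\<alpha> ^^ r) m \<noteq> m"
      using funpow_inj[of r m 0] r Suc by auto
    ultimately have "\<not> (\<alpha> ^^ r) m \<le> m" by simp
    then show ?thesis using r Suc by (simp add: row_at_def del: funpow.simps)
  qed (use r in \<open>simp add: row_at_def\<close>)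
qed

text \<open>By induction: a cycle minimum appends its row, and any other \<open>Suc i\<close> fills
  the one cell of value \<open>Suc i\<close>. The remaining rows do not change, since they belong to
  other cycles.\<close>

lemma rows_after_eq: "rows_after \<alpha> i = rows_at i"
proof (induction i)
  case 0
  show ?case by (simp add: rows_at_def opened_def)
next
  case (Suc i)
  show ?case
  proof (cases "cycle_min \<alpha> (Suc i) = Suc i")
    case True
    have "opened (Suc i) = opened i @ [Suc i]"
      using True by (simp add: opened_def)
    moreover have "row_at (Suc i) m = row_at i m" if "m \<in> set (opened i)" for m
    proof -
      have "m \<noteq> cycle_min \<alpha> (Suc i)"
        using that True by (simp add: set_opened)
      with that show ?thesis by (intro row_at_Suc not_in_orbit_opened)
    qed
    ultimately show ?thesis
      using True Suc by (simp add: rows_at_def place_def row_at_cycle_min)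
  next
    case False
    define c s where "c = cycle_min \<alpha> (Suc i)" and "s = funpow_dist \<alpha> c (Suc i)"
    have opened_Suc: "opened (Suc i) = opened i"
      using False by (simp add: opened_def)
    have "c \<le> i"
      using cycle_min_less[OF False] by (simp add: c_def)
    then obtain q where q: "q < length (opened i)" "opened i ! q = c"
      "(q, s) \<in> set (cells (rows_at i))" "cell_value i (q, s) = Suc i"
      "cell_of (rows_at i) c = (q, 0)"
      using ex_cell[of "Suc i" i] unfolding c_def s_def by blast
    have target: "target_cell \<alpha> (Suc i) (rows_at i) = (q, s)"
      using q by (simp add: target_cell_def Let_def c_def s_def)
    have s: "s < card (orbit \<alpha> c)" "(\<alpha> ^^ s) c = Suc i"
      using q by (simp_all add: mem_cells_rows_at cell_value_def)
    have row: "(row_at i c)[s := Some (Suc i)] = row_at (Suc i) c"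
    proof (rule nth_equalityI)
      fix r assume "r < length ((row_at i c)[s := Some (Suc i)])"
      then have r: "r < card (orbit \<alpha> c)" by simp
      show "(row_at i c)[s := Some (Suc i)] ! r = row_at (Suc i) c ! r"
      proof (cases "r = s")
        case False
        then have "(\<alpha> ^^ r) c \<noteq> Suc i"
          using funpow_inj[of r c s] r s by auto
        with False r show ?thesis by (simp add: row_at_def le_Suc_eq)
      qed (use s in \<open>simp add: row_at_def\<close>)
    qed simp
    have "(rows_at i)[q := (rows_at i ! q)[s := Some (Suc i)]] = rows_at (Suc i)"
    proof (rule nth_equalityI)
      fix k assume "k < length ((rows_at i)[q := (rows_at i ! q)[s := Some (Suc i)]])"
      then have k: "k < length (opened i)" by (simp add: rows_at_def)
      show "(rows_at i)[q := (rows_at i ! q)[s := Some (Suc i)]] ! k = rows_at (Suc i) ! k"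
      proof (cases "k = q")
        case True
        with q k row show ?thesis by (simp add: rows_at_def opened_Suc)
      next
        case False
        \<comment> \<open>Distinct rows have distinct minima, so row \<open>k\<close> belongs to a
          cycle avoiding \<open>Suc i\<close>.\<close>
        then have "opened i ! k \<noteq> c"
          using q k distinct_opened nth_eq_iff_index_eq by blast
        then have "Suc i \<notin> orbit \<alpha> (opened i ! k)"
          using k by (intro not_in_orbit_opened[of _ i]) (auto simp: c_def)
        with False k show ?thesis by (simp add: rows_at_def opened_Suc row_at_Suc)
      qed
    qed (simp add: rows_at_def opened_Suc)
    with False target show ?thesis by (simp add: place_def Suc)
  qed
qed

section \<open>The pivot and the letter \<open>b_1\<close>\<close>

text \<open>If \<open>x\<close> closes its row then \<open>\<alpha> x\<close> is the minimum of its cycle and already placed, so the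
  condition \<open>i < \<alpha> x\<close> covers this case too.\<close>

lemma ex_free_right_cell_iff:
  "(\<exists>p\<in>set (cells (rows_at i)). content (rows_at i) p = Some x \<and>
      right_cell p \<in> set (free_cells (rows_at i))) \<longleftrightarrow> 0 < x \<and> x \<le> i \<and> i < \<alpha> x"
    (is "?L \<longleftrightarrow> ?R")
proof
  assume ?L
  then obtain p where p: "p \<in> set (cells (rows_at i))" "content (rows_at i) p = Some x"
    "right_cell p \<in> set (cells (rows_at i))" "content (rows_at i) (right_cell p) = None"
    by (auto simp: free_cells_def)
  then have x: "x = cell_value i p" "x \<le> i" "i < cell_value i (right_cell p)"
    by (auto simp: content_rows_at split: if_splits)
  with cell_value_pos[OF p(1)] show ?R
    by (simp add: cell_value_def right_cell_def)
next
  assume R: ?R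
  define s where "s = funpow_dist \<alpha> (cycle_min \<alpha> x) x"
  obtain q where q: "q < length (opened i)" "opened i ! q = cycle_min \<alpha> x"
    "(q, s) \<in> set (cells (rows_at i))" "cell_value i (q, s) = x"
    using ex_cell[of x i] R cycle_min_self_le[of x] unfolding s_def by (metis order_trans)
  have s: "(\<alpha> ^^ Suc s) (cycle_min \<alpha> x) = \<alpha> x"
    by (simp add: s_def funpow_dist)
  have "Suc s \<noteq> card (orbit \<alpha> (cycle_min \<alpha> x))"
  proof
    assume "Suc s = card (orbit \<alpha> (cycle_min \<alpha> x))"
    then have "\<alpha> x = cycle_min \<alpha> x"
      using s funpow_card_orbit by metis
    then show False
      using R cycle_min_self_le[of x] by simp
  qed
  then have "right_cell (q, s) \<in> set (cells (rows_at i))"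
    using q by (auto simp: mem_cells_rows_at right_cell_def)
  moreover have "cell_value i (right_cell (q, s)) = \<alpha> x"
    using s q by (simp add: cell_value_def right_cell_def)
  ultimately show ?L
    using R q by (intro bexI[of _ "(q, s)"]) (simp_all add: free_cells_def content_rows_at)
qed

lemma pivot_rows_at: "pivot (rows_at i) = (LEAST x. 0 < x \<and> x \<le> i \<and> i < \<alpha> x)"
  unfolding pivot_def ex_free_right_cell_iff ..

lemma image_pos: "0 < x \<Longrightarrow> 0 < \<alpha> x"
  using injD[OF inj, of x 0] by (auto simp: zero_fixed intro: gr0I)

text \<open>The cycle of \<open>x\<close> enters \<open>{1..i}\<close> at its minimum and, as
  \<open>\<alpha>\<close> maps this set into itself, never leaves it.\<close>

lemma le_of_cycle_min_le:
  assumes closed: "\<forall>y\<in>{1..i}. \<alpha> y \<le> i" and "0 < x" "cycle_min \<alpha> x \<le> i"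
  shows "x \<le> i"
proof -
  have "0 < (\<alpha> ^^ r) (cycle_min \<alpha> x) \<and> (\<alpha> ^^ r) (cycle_min \<alpha> x) \<le> i" for r
  proof (induction r)
    case 0
    show ?case using assms(2,3) by (simp add: cycle_min_pos_iff)
  next
    case (Suc r)
    with closed show ?case by (simp add: image_pos)
  qed
  from this[of "funpow_dist \<alpha> (cycle_min \<alpha> x) x"] show ?thesis
    by (simp add: funpow_dist)
qed

text \<open>Otherwise \<open>\<alpha>\<close> would preserve \<open>{1..i}\<close>, which the cycle
  of \<open>Suc i\<close> meets, and \<open>Suc i\<close> would lie in it. This makes the
  \<open>LEAST\<close> in the pivot meaningful.\<close>

lemma ex_excedance:
  assumes "cycle_min \<alpha> (Suc i) \<noteq> Suc i"
  shows "\<exists>x. 0 < x \<and> x \<le> i \<and> i < \<alpha> x"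
proof (rule ccontr)
  assume "\<nexists>x. 0 < x \<and> x \<le> i \<and> i < \<alpha> x"
  then have "\<forall>y\<in>{1..i}. \<alpha> y \<le> i" by (force simp: not_less)
  from le_of_cycle_min_le[OF this, of "Suc i"] show False
    using cycle_min_less[OF assms] by simp
qed

text \<open>The list starts at the cell to the right of the pivot \<open>x\<close>, which is
  reserved for \<open>\<alpha> x\<close>. Minimality of the pivot turns the equation
  \<open>\<alpha> x = Suc i\<close> into a condition that no longer mentions rows.\<close>

lemma rank_eq_1_iff:
  assumes "cycle_min \<alpha> (Suc i) \<noteq> Suc i"
  shows "rank_in (target_cell \<alpha> (Suc i) (rows_at i)) (free_cells_from_pivot (rows_at i)) = 1 \<longleftrightarrow>
    (\<exists>x. 0 < x \<and> x \<le> i \<and> \<alpha> x = Suc i \<and> (\<forall>y\<in>{1..<x}. \<alpha> y < Suc i))"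
proof -
  define P where "P x \<longleftrightarrow> 0 < x \<and> x \<le> i \<and> i < \<alpha> x" for x
  define x where "x = pivot (rows_at i)"
  have x_Least: "x = Least P"
    unfolding x_def pivot_rows_at P_def ..
  have P: "P x"
    unfolding x_Least using ex_excedance[OF assms] unfolding P_def by (rule LeastI_ex)
  then obtain p where p: "p \<in> set (cells (rows_at i))" "content (rows_at i) p = Some x"
    "right_cell p \<in> set (free_cells (rows_at i))"
    using ex_free_right_cell_iff[of i x] unfolding P_def by blast
  then have val: "cell_value i p = x" and "x \<le> i"
    by (auto simp: content_rows_at split: if_splits)
  then have cell: "cell_of (rows_at i) x = p"
    using cell_of_rows_at[OF p(1)] by simp
  have right: "right_cell p \<in> set (cells (rows_at i))" "cell_value i (right_cell p) = \<alpha> x"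
    using p val by (auto simp: free_cells_def cell_value_def right_cell_def)
  have "cycle_min \<alpha> (Suc i) \<le> i"
    using cycle_min_less[OF assms] by simp
  note target = target_cell_rows_at[OF zero_less_Suc this]
  have "rank_in (target_cell \<alpha> (Suc i) (rows_at i)) (free_cells_from_pivot (rows_at i)) = 1 \<longleftrightarrow>
      target_cell \<alpha> (Suc i) (rows_at i) = right_cell p"
    unfolding free_cells_from_pivot_def x_def[symmetric] cell using p(3) by (rule rank_in_cyclic_from)
  also have "\<dots> \<longleftrightarrow> \<alpha> x = Suc i"
    using target right cell_value_inj by metis
  also have "\<dots> \<longleftrightarrow> (\<exists>x. 0 < x \<and> x \<le> i \<and> \<alpha> x = Suc i \<and> (\<forall>y\<in>{1..<x}. \<alpha> y < Suc i))"
  proof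
    assume "\<alpha> x = Suc i"
    moreover have "\<alpha> y < Suc i" if "y \<in> {1..<x}" for y
    proof -
      have "\<not> P y"
        using not_less_Least[of y P] that x_Least by simp
      then show ?thesis using that \<open>x \<le> i\<close> by (simp add: P_def)
    qed
    ultimately show "\<exists>x. 0 < x \<and> x \<le> i \<and> \<alpha> x = Suc i \<and> (\<forall>y\<in>{1..<x}. \<alpha> y < Suc i)"
      using P by (auto simp: P_def)
  next
    assume "\<exists>x. 0 < x \<and> x \<le> i \<and> \<alpha> x = Suc i \<and> (\<forall>y\<in>{1..<x}. \<alpha> y < Suc i)"
    then obtain z where z: "0 < z" "z \<le> i" "\<alpha> z = Suc i" "\<forall>y\<in>{1..<z}. \<alpha> y < Suc i"
      by blast
    \<comment> \<open>An earlier pivot would contradict the bound on images before \<open>z\<close>,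
      because the image of the pivot exceeds \<open>i\<close>.\<close>
    have "\<not> x < z"
      using bspec[OF z(4), of x] P by (auto simp: P_def)
    moreover have "x \<le> z"
      unfolding x_Least using z by (intro Least_le) (simp add: P_def)
    ultimately show "\<alpha> x = Suc i" using z by simp
  qed
  finally show ?thesis .
qed

section \<open>Occurrences of \<open>b_0\<close> and the number of cycles\<close>

lemma Delta_0 [simp]: "Delta \<alpha> 0 = []"
  by (simp add: Delta_def)

lemma Delta_Suc: "Delta \<alpha> (Suc i) = Delta \<alpha> i @ factor \<alpha> (Suc i)"
  by (simp add: Delta_def)

lemma prefix_Delta_mono: "i \<le> j \<Longrightarrow> prefix (Delta \<alpha> i) (Delta \<alpha> j)"
  by (induction rule: dec_induct) (simp_all add: Delta_Suc)

lemma factor_cycle_min: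
  "cycle_min \<alpha> x = x \<Longrightarrow> factor \<alpha> x = replicate (card (orbit \<alpha> x)) A @ [B 0]"
  by (simp add: factor_def)

lemma factor_not_cycle_min:
  "cycle_min \<alpha> (Suc i) \<noteq> Suc i \<Longrightarrow> factor \<alpha> (Suc i) =
     [B (rank_in (target_cell \<alpha> (Suc i) (rows_at i)) (free_cells_from_pivot (rows_at i)))]"
  by (simp add: factor_def rows_after_eq Let_def)

text \<open>Meant for the letters \<open>B 0\<close> and \<open>B 1\<close>, which occur at most
  once in each factor, so that occurrences correspond to placement times.\<close>

lemma count_list_Delta:
  assumes "\<And>i. count_list (factor \<alpha> (Suc i)) l = of_bool (P (Suc i))"
  shows "count_list (Delta \<alpha> k) l = card {x\<in>{1..k}. P x}"
proof (induction k)
  case (Suc k)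
  have "{x\<in>{1..Suc k}. P x} = (if P (Suc k) then insert (Suc k) else id) {x\<in>{1..k}. P x}"
    by (auto simp: le_Suc_eq)
  then show ?case
    using Suc assms by (simp add: Delta_Suc)
qed simp

text \<open>Ranks start at 1, so only the opening of a row produces \<open>B 0\<close>.\<close>

lemma count_B0: "count_list (Delta \<alpha> k) (B 0) = card {x\<in>{1..k}. cycle_min \<alpha> x = x}"
proof (rule count_list_Delta)
  show "count_list (factor \<alpha> (Suc i)) (B 0) = of_bool (cycle_min \<alpha> (Suc i) = Suc i)" for i
    by (cases "cycle_min \<alpha> (Suc i) = Suc i")
      (simp_all add: factor_cycle_min factor_not_cycle_min count_list_replicate rank_in_def)
qed

lemma card_cycles_on: "card (cycles_on \<alpha> n) = count_list (Delta \<alpha> n) (B 0)"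
proof -
  have "cycles_on \<alpha> n = orbit \<alpha> ` {x\<in>{1..n}. cycle_min \<alpha> x = x}"
  proof (intro subset_antisym subsetI)
    fix C assume "C \<in> cycles_on \<alpha> n"
    then obtain x where x: "x \<in> {1..n}" "C = orbit \<alpha> x"
      by (auto simp: cycles_on_def)
    then have "cycle_min \<alpha> x \<in> {1..n}"
      using orbit_subset cycle_min_in_orbit by blast
    with x show "C \<in> orbit \<alpha> ` {x\<in>{1..n}. cycle_min \<alpha> x = x}"
      by (intro image_eqI[of _ _ "cycle_min \<alpha> x"]) (simp_all add: orbit_cycle_min cycle_min_idem)
  qed (auto simp: cycles_on_def)
  moreover have "inj_on (orbit \<alpha>) {x\<in>{1..n}. cycle_min \<alpha> x = x}"
    by (rule inj_onI) (metis (mono_tags, lifting) cycle_min_eq_iff mem_Collect_eq)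
  ultimately show ?thesis
    by (simp add: count_B0 card_image)
qed

section \<open>Occurrences of \<open>b_1\<close> and left-to-right maxima\<close>

lemma decomposable_iff: "decomposable \<alpha> n \<longleftrightarrow> (\<exists>p\<in>{1..<n}. \<forall>i\<in>{1..p}. \<alpha> i \<le> p)"
  by (auto simp: decomposable_def Suc_le_eq image_pos)

lemma count_B1:
  "count_list (Delta \<alpha> k) (B 1) =
     card {z\<in>{1..k}. \<exists>x. 0 < x \<and> x < z \<and> \<alpha> x = z \<and> (\<forall>y\<in>{1..<x}. \<alpha> y < z)}"
proof (rule count_list_Delta)
  fix i
  let ?P = "\<exists>x. 0 < x \<and> x < Suc i \<and> \<alpha> x = Suc i \<and> (\<forall>y\<in>{1..<x}. \<alpha> y < Suc i)"
  show "count_list (factor \<alpha> (Suc i)) (B 1) = of_bool ?P"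
  proof (cases "cycle_min \<alpha> (Suc i) = Suc i")
    case True
    \<comment> \<open>If \<open>\<alpha> x\<close> is its own cycle minimum, it is also that of
      \<open>x\<close>, so \<open>x < \<alpha> x\<close> fails.\<close>
    then have "\<not> ?P"
      by (metis cycle_min_self_le cycle_min_step linorder_not_less)
    moreover have "count_list (factor \<alpha> (Suc i)) (B 1) = 0"
      using True by (simp add: factor_cycle_min count_list_replicate)
    ultimately show ?thesis by simp
  next
    case False
    show ?thesis
      using rank_eq_1_iff[OF False] by (simp add: factor_not_cycle_min[OF False] less_Suc_eq_le)
  qed
qed

lemma indecomposable_maximum_excedance:
  assumes "indecomposable \<alpha> n" "n \<noteq> 1" "x \<in> left_to_right_maxima \<alpha> n"
  shows "x < \<alpha> x"
proof (rule ccontr)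
  assume "\<not> x < \<alpha> x"
  have x: "x \<in> {1..n}" and max: "\<forall>y\<in>{1..<x}. \<alpha> y < \<alpha> x"
    using assms(3) by (auto simp: left_to_right_maxima_def)
  \<comment> \<open>Earlier images lie below \<open>\<alpha> x\<close>, which is at most
    \<open>x\<close>; so \<open>{1..x}\<close> is invariant.\<close>
  have "\<alpha> y \<le> x" if "y \<in> {1..x}" for y
    using bspec[OF max, of y] \<open>\<not> x < \<alpha> x\<close> that by (cases "y = x") auto
  then have "x = n"
    using assms(1) x unfolding indecomposable_def decomposable_iff
    by (metis atLeastAtMost_iff atLeastLessThan_iff nat_less_le)
  \<comment> \<open>Now the images before position \<open>n\<close> lie strictly below
    \<open>\<alpha> n\<close>, so \<open>{1..n - 1}\<close> is invariant too. It is nonempty because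
    \<open>n \<noteq> 1\<close>, which gives a decomposition.\<close>
  have "\<alpha> y \<le> n - 1" if "y \<in> {1..n - 1}" for y
  proof -
    have "y \<in> {1..<x}"
      using that \<open>x = n\<close> by auto
    then have "\<alpha> y < \<alpha> x"
      using max by blast
    with \<open>\<not> x < \<alpha> x\<close> \<open>x = n\<close> show ?thesis by simp
  qed
  moreover have "n - 1 \<in> {1..<n}"
    using x \<open>n \<noteq> 1\<close> by auto
  ultimately show False
    using assms(1) unfolding indecomposable_def decomposable_iff by blast
qed

text \<open>A maximum at position \<open>x\<close> yields its \<open>B 1\<close> at time
  \<open>\<alpha> x\<close>. The injective map \<open>\<alpha>\<close> therefore matches positions
  of maxima with times of \<open>B 1\<close>.\<close>

lemma card_left_to_right_maxima:
  assumes "indecomposable \<alpha> n" "n \<noteq> 1"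
  shows "card (left_to_right_maxima \<alpha> n) = count_list (Delta \<alpha> n) (B 1)"
proof -
  have "\<alpha> ` left_to_right_maxima \<alpha> n =
      {z\<in>{1..n}. \<exists>x. 0 < x \<and> x < z \<and> \<alpha> x = z \<and> (\<forall>y\<in>{1..<x}. \<alpha> y < z)}"
  proof (intro subset_antisym subsetI)
    fix z assume "z \<in> \<alpha> ` left_to_right_maxima \<alpha> n"
    then obtain x where x: "x \<in> left_to_right_maxima \<alpha> n" "z = \<alpha> x" by blast
    moreover have "\<alpha> x \<in> {1..n}"
      using permutes_in_image[OF permutes] x by (auto simp: left_to_right_maxima_def)
    ultimately show "z \<in> {z\<in>{1..n}. \<exists>x. 0 < x \<and> x < z \<and> \<alpha> x = z \<and> (\<forall>y\<in>{1..<x}. \<alpha> y < z)}"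
      using indecomposable_maximum_excedance[OF assms x(1)]
      by (auto simp: left_to_right_maxima_def intro!: exI[of _ x])
  next
    fix z assume "z \<in> {z\<in>{1..n}. \<exists>x. 0 < x \<and> x < z \<and> \<alpha> x = z \<and> (\<forall>y\<in>{1..<x}. \<alpha> y < z)}"
    then show "z \<in> \<alpha> ` left_to_right_maxima \<alpha> n"
      by (auto simp: left_to_right_maxima_def)
  qed
  then show ?thesis
    using card_image[OF inj_on_subset[OF inj], of "left_to_right_maxima \<alpha> n"]
    unfolding count_B1 by simp
qed

section \<open>The Dyck path and its decompositions\<close>

lemma count_B_Delta: "count_list (map erase_index (Delta \<alpha> i)) StepB = i"
proof (induction i)
  case (Suc i)
  then show ?case
    by (cases "cycle_min \<alpha> (Suc i) = Suc i")
      (simp_all add: Delta_Suc factor_cycle_min factor_not_cycle_min count_list_replicate)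
qed simp

text \<open>The factor of a cycle minimum contributes one up-step for each element of its cycle, all
  at once; other factors contribute none.\<close>

lemma count_A_Delta:
  assumes "i \<le> n"
  shows "count_list (map erase_index (Delta \<alpha> i)) StepA = card {x\<in>{1..n}. cycle_min \<alpha> x \<le> i}"
  using assms
proof (induction i)
  case 0
  have "{x\<in>{1..n}. cycle_min \<alpha> x \<le> 0} = {}"
    by (auto simp: not_le cycle_min_pos_iff)
  then show ?case by simp
next
  case (Suc i)
  have Un: "{x\<in>{1..n}. cycle_min \<alpha> x \<le> Suc i} =
      {x\<in>{1..n}. cycle_min \<alpha> x \<le> i} \<union> {x\<in>{1..n}. cycle_min \<alpha> x = Suc i}"
    by (auto simp: le_Suc_eq)
  have card: "card {x\<in>{1..n}. cycle_min \<alpha> x \<le> Suc i} =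
      card {x\<in>{1..n}. cycle_min \<alpha> x \<le> i} + card {x\<in>{1..n}. cycle_min \<alpha> x = Suc i}"
    unfolding Un by (subst card_Un_disjoint) auto
  show ?case
  proof (cases "cycle_min \<alpha> (Suc i) = Suc i")
    case True
    have "{x\<in>{1..n}. cycle_min \<alpha> x = Suc i} = orbit \<alpha> (Suc i)"
    proof (intro subset_antisym subsetI)
      fix x assume "x \<in> {x\<in>{1..n}. cycle_min \<alpha> x = Suc i}"
      then show "x \<in> orbit \<alpha> (Suc i)" using in_orbit_cycle_min[of x] by simp
    next
      fix x assume "x \<in> orbit \<alpha> (Suc i)"
      with True cycle_min_eq[of x "Suc i"] orbit_subset[of "Suc i"] Suc.prems
      show "x \<in> {x\<in>{1..n}. cycle_min \<alpha> x = Suc i}" by auto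
    qed
    with card have "card {x\<in>{1..n}. cycle_min \<alpha> x \<le> Suc i} =
        card {x\<in>{1..n}. cycle_min \<alpha> x \<le> i} + card (orbit \<alpha> (Suc i))"
      by simp
    with Suc True show ?thesis
      by (simp add: Delta_Suc factor_cycle_min count_list_replicate)
  next
    case False
    have "{x\<in>{1..n}. cycle_min \<alpha> x = Suc i} = {}"
      using False cycle_min_idem by (metis (mono_tags, lifting) Collect_empty_eq)
    with card have "card {x\<in>{1..n}. cycle_min \<alpha> x \<le> Suc i} = card {x\<in>{1..n}. cycle_min \<alpha> x \<le> i}"
      by simp
    with Suc False show ?thesis
      by (simp add: Delta_Suc factor_not_cycle_min)
  qed
qed

lemma cycle_min_le_superset: "i \<le> n \<Longrightarrow> {1..i} \<subseteq> {x\<in>{1..n}. cycle_min \<alpha> x \<le> i}"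
  by (auto intro: order_trans[OF cycle_min_self_le])

lemma le_count_A_Delta: "i \<le> n \<Longrightarrow> i \<le> count_list (map erase_index (Delta \<alpha> i)) StepA"
  using card_mono[OF _ cycle_min_le_superset, of i] by (simp add: count_A_Delta)

lemma count_A_Delta_eq_iff:
  assumes "i \<le> n"
  shows "count_list (map erase_index (Delta \<alpha> i)) StepA = i \<longleftrightarrow> (\<forall>x\<in>{1..i}. \<alpha> x \<le> i)"
proof
  assume "count_list (map erase_index (Delta \<alpha> i)) StepA = i"
  \<comment> \<open>An inclusion between finite sets of equal cardinality is an equality.\<close>
  then have eq: "{1..i} = {x\<in>{1..n}. cycle_min \<alpha> x \<le> i}"
    using assms by (intro card_subset_eq cycle_min_le_superset) (simp_all add: count_A_Delta)
  show "\<forall>x\<in>{1..i}. \<alpha> x \<le> i"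
  proof
    fix x assume "x \<in> {1..i}"
    then have "\<alpha> x \<in> {x\<in>{1..n}. cycle_min \<alpha> x \<le> i}"
      using permutes_in_image[OF permutes, of x] unfolding eq by (simp add: cycle_min_step)
    then show "\<alpha> x \<le> i" unfolding eq[symmetric] by simp
  qed
next
  assume closed: "\<forall>x\<in>{1..i}. \<alpha> x \<le> i"
  have "{x\<in>{1..n}. cycle_min \<alpha> x \<le> i} \<subseteq> {1..i}"
    using le_of_cycle_min_le[OF closed] by (simp add: subset_iff Suc_le_eq)
  with cycle_min_le_superset[OF assms] have "{x\<in>{1..n}. cycle_min \<alpha> x \<le> i} = {1..i}"
    by (rule subset_antisym[rotated])
  then show "count_list (map erase_index (Delta \<alpha> i)) StepA = i"
    using assms by (simp add: count_A_Delta)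
qed

text \<open>In a factor the up-steps precede the single down-step. A prefix ending inside a factor
  thus adds only up-steps to a prefix with no deficit, so balanced prefixes end at factor
  boundaries.\<close>

lemma prefix_Delta:
  assumes "i \<le> n" "prefix v (map erase_index (Delta \<alpha> i))"
  shows "count_list v StepB \<le> count_list v StepA \<and>
    (count_list v StepA = count_list v StepB \<longrightarrow> (\<exists>j\<le>i. v = map erase_index (Delta \<alpha> j)))"
  using assms
proof (induction i)
  case (Suc i)
  let ?w = "map erase_index (Delta \<alpha> i)" and ?u = "map erase_index (factor \<alpha> (Suc i))"
  from Suc.prems(2) have "prefix v (?w @ ?u)"
    by (simp add: Delta_Suc)
  then consider "prefix v ?w" | "v = map erase_index (Delta \<alpha> (Suc i))"
    | k where "0 < k" "v = ?w @ replicate k StepA"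
    unfolding prefix_append
  proof (elim disjE exE conjE)
    fix u assume u: "v = ?w @ u" "prefix u ?u"
    show thesis
    proof (cases "u = ?u \<or> u = []")
      case True
      with u that(1,2) show thesis by (auto simp: Delta_Suc)
    next
      case False
      \<comment> \<open>A one-letter factor has no proper nonempty prefix, so the cut lies inside an
        opening factor.\<close>
      have "cycle_min \<alpha> (Suc i) = Suc i"
        using False u(2) by (rule_tac ccontr) (auto simp: factor_not_cycle_min prefix_Cons)
      then have "?u = replicate (card (orbit \<alpha> (Suc i))) StepA @ [StepB]"
        by (simp add: factor_cycle_min)
      with False u(2) have "prefix u (replicate (card (orbit \<alpha> (Suc i))) StepA)"
        by (metis prefix_snoc)
      then have "set u \<subseteq> {StepA}"
        using set_mono_prefix by fastforce
      then have "u = replicate (length u) StepA"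
        by (metis replicate_eqI singletonD subsetD)
      with False u(1) that(3) show thesis by blast
    qed
  qed
  then show ?case
  proof cases
    case 1
    with Suc show ?thesis by (auto intro: le_SucI)
  next
    case 2
    with le_count_A_Delta[OF Suc.prems(1)] show ?thesis by (auto simp: count_B_Delta)
  next
    case 3
    with le_count_A_Delta[of i] Suc.prems(1) show ?thesis
      by (simp add: count_B_Delta count_list_replicate)
  qed
qed simp

lemma dyck_path_Delta: "dyck_path (map erase_index (Delta \<alpha> n))"
proof -
  have "\<alpha> x \<le> n" if "x \<in> {1..n}" for x
    using permutes_in_image[OF permutes, of x] that by simp
  then have "count_list (map erase_index (Delta \<alpha> n)) StepA = n"
    by (subst count_A_Delta_eq_iff) auto
  moreover have "count_list (take k (map erase_index (Delta \<alpha> n))) StepB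
      \<le> count_list (take k (map erase_index (Delta \<alpha> n))) StepA" for k
    using prefix_Delta[OF order_refl take_is_prefix] by blast
  ultimately show ?thesis
    unfolding dyck_path_def by (simp add: count_B_Delta)
qed

lemma indecomposable_iff_primitive:
  assumes "n \<noteq> 0"
  shows "indecomposable \<alpha> n \<longleftrightarrow> primitive (Delta \<alpha> n)"
proof -
  let ?w = "\<lambda>i. map erase_index (Delta \<alpha> i)"
  have "decomposable \<alpha> n \<longleftrightarrow>
      (\<exists>u v. dyck_path u \<and> dyck_path v \<and> u \<noteq> [] \<and> v \<noteq> [] \<and> ?w n = u @ v)"
  proof
    assume "decomposable \<alpha> n"
    then obtain p where p: "p \<in> {1..<n}" "count_list (?w p) StepA = p"
      using count_A_Delta_eq_iff by (auto simp: decomposable_iff)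
    have "prefix (?w p) (?w n)"
      using p(1) by (intro map_mono_prefix prefix_Delta_mono) simp
    then obtain v where v: "?w n = ?w p @ v"
      by (rule prefixE)
    have "?w p \<noteq> []" "v \<noteq> []"
      using p(1) v count_B_Delta[of p] count_B_Delta[of n] by auto
    moreover have "dyck_path (?w p)" "dyck_path v"
      using dyck_path_Delta dyck_path_append[of "?w p" v] p(2) by (simp_all add: v count_B_Delta)
    ultimately show "\<exists>u v. dyck_path u \<and> dyck_path v \<and> u \<noteq> [] \<and> v \<noteq> [] \<and> ?w n = u @ v"
      using v by blast
  next
    assume "\<exists>u v. dyck_path u \<and> dyck_path v \<and> u \<noteq> [] \<and> v \<noteq> [] \<and> ?w n = u @ v"
    then obtain u v where uv: "dyck_path u" "u \<noteq> []" "v \<noteq> []" "?w n = u @ v"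
      by blast
    from uv(1) have "count_list u StepA = count_list u StepB"
      by (simp add: dyck_path_def)
    with prefix_Delta[of n u] uv(4) obtain j where j: "j \<le> n" "u = ?w j"
      by auto
    \<comment> \<open>The cut is interior because both \<open>u\<close> and \<open>v\<close> are
      nonempty.\<close>
    have "j \<noteq> 0"
      using uv(2) j(2) by (rule_tac notI) simp
    moreover have "j \<noteq> n"
      using uv(3,4) j(2) by (rule_tac notI) simp
    ultimately have "j \<in> {1..<n}"
      using j(1) by simp
    moreover have "count_list (?w j) StepA = j"
      using uv(1) j(2) by (simp add: dyck_path_def count_B_Delta)
    ultimately show "decomposable \<alpha> n"
      using count_A_Delta_eq_iff j(1) by (auto simp: decomposable_iff)
  qed
  moreover have "?w n \<noteq> []"
    using count_B_Delta[of n] assms by auto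
  ultimately show ?thesis
    unfolding indecomposable_def primitive_def primitive_dyck_path_def
    using dyck_path_Delta by blast
qed

end

text \<open>The empty permutation is indecomposable but its empty word is not primitive, hence
  \<open>n \<noteq> 0\<close>. For \<open>n = 1\<close> there is one left-to-right maximum while the
  word \<open>[A, B 0]\<close> contains no \<open>B 1\<close>.\<close>

theorem theorem3:
  fixes \<alpha> :: "nat \<Rightarrow> nat" and n :: nat and f :: "letter list"
  assumes "\<alpha> permutes {1..n}"
    and "f = Delta \<alpha> n"
  shows "card (cycles_on \<alpha> n) = count_list f (B 0)
    \<and> (n \<noteq> 0 \<longrightarrow> (indecomposable \<alpha> n \<longleftrightarrow> primitive f))
    \<and> (n \<noteq> 1 \<longrightarrow> indecomposable \<alpha> n \<longrightarrow>
         card (left_to_right_maxima \<alpha> n) = count_list f (B 1))"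
proof -
  interpret interval_permutation \<alpha> n
    by (rule interval_permutation.intro[OF assms(1)])
  show ?thesis
    unfolding assms(2)
    by (intro conjI impI card_cycles_on indecomposable_iff_primitive card_left_to_right_maxima)
qed

end
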